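(* For every submodular stochastic depletion problem, for all states $s,s'\in\mathcal S$ such that $x(s)\ge x(s')$ and $t(s)=t(s')$, one has $J^*(s)\ge J^*(s')$.
   Context: Submodular stochastic depletion problem (clairvoyant form). There are $M$ item types, with at most $\bar x_m\in\mathbb Z_+$ items of type $m$, $\bar x=(\bar x_1,\dots,\bar x_M)$; a finite nonempty set $\mathcal A$ of activities; a horizon $T$ (a positive integer); and, for each $A\in\mathcal A$, a fixed known sequence $P_t(A)=(P_{t,1}(A),\dots,P_{t,M}(A))\in[0,1]^M$, $t=0,1,2,\dots$. The state space is $\mathcal S=\{(x,t): x\in\prod_{m}\{0,\dots,\bar x_m\},\ t\in\{0,\dots,T\}\}$; for $s=(x,t)$ write $x(s)=x$, $t(s)=t$. Vector inequalities are componentwise. If activity $A$ is used in state $s=(x,t)$ with $t<T$, a random vector $X_t=(X_{t,m})_m$ of items is depleted, where the $X_{t,m}$ are independent of each other and (given $x$ and $P_t(A)$) of the past, and $X_{t,m}\sim\mathrm{Binomial}(x_m,P_{t,m}(A))$. The next state is $(x-X_t,t+1)$ and the reward earned is $R(s,A)=w(\bar x-x+X_t)-w(\bar x-x)$, where $w:\mathbb Z_+^M\to\mathbb R$ satisfies: (monotonicity) $w(y)\ge w(y')$ whenever $y\ge y'$; (submodularity) for $e\in\mathbb Z_+^M$, $w(y+e)-w(y)\le w(y'+e)-w(y')$ whenever $y\ge y'$. A policy is a map $\pi:\mathcal S\to\mathcal A$; $J^\pi(s)=E\big[\sum_{t'=t(s)}^{T-1}R(S_{t'},\pi(S_{t'}))\mid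 S_{t(s)}=s\big]$, where $S_t$ is the state at time $t$ under $\pi$, and $J^*(s)=\max_\pi J^\pi(s)$. *)

theory Defs
  imports "HOL-Probability.Probability" "HOL-Library.Function_Algebras"
begin

text \<open>
  Item types are the elements of the finite type \<open>'m\<close>, so an item vector is a function
  \<open>'m \<Rightarrow> nat\<close>; order, addition and subtraction on such functions are the pointwise ones.
\<close>

type_synonym 'm state = "('m \<Rightarrow> nat) \<times> nat"

record ('a, 'm) depletion_problem =
  capacity :: "'m \<Rightarrow> nat"
  activities :: "'a set"
  horizon :: nat
  depl_prob :: "nat \<Rightarrow> 'a \<Rightarrow> 'm \<Rightarrow> real"
  val :: "('m \<Rightarrow> nat) \<Rightarrow> real"

definition submodular :: "(('m \<Rightarrow> nat) \<Rightarrow> real) \<Rightarrow> bool" where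
  "submodular w \<longleftrightarrow> (\<forall>y y' e. y \<ge> y' \<longrightarrow> w (y + e) - w y \<le> w (y' + e) - w y')"

definition submodular_depletion_problem :: "('a, 'm::finite) depletion_problem \<Rightarrow> bool" where
  "submodular_depletion_problem D \<longleftrightarrow>
     finite (activities D) \<and> activities D \<noteq> {} \<and>
     horizon D > 0 \<and>
     (\<forall>t. \<forall>A\<in>activities D. \<forall>m. 0 \<le> depl_prob D t A m \<and> depl_prob D t A m \<le> 1) \<and>
     mono (val D) \<and> submodular (val D)"

definition states :: "('a, 'm::finite) depletion_problem \<Rightarrow> 'm state set" where
  "states D = {(x, t). x \<le> capacity D \<and> t \<le> horizon D}"

text \<open>
  The law of the vector of depleted items when an activity is used in a given state; the components
  are independent. Its support only contains vectors bounded by the current items, so on states of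
  the problem the truncated subtractions below are genuine ones.
\<close>

definition depletion :: "('a, 'm::finite) depletion_problem \<Rightarrow> 'm state \<Rightarrow> 'a \<Rightarrow> ('m \<Rightarrow> nat) pmf" where
  "depletion D s A = Pi_pmf UNIV 0 (\<lambda>m. binomial_pmf (fst s m) (depl_prob D (snd s) A m))"

definition next_state :: "'m state \<Rightarrow> ('m \<Rightarrow> nat) \<Rightarrow> 'm state" where
  "next_state s X = (fst s - X, Suc (snd s))"

definition reward :: "('a, 'm::finite) depletion_problem \<Rightarrow> 'm state \<Rightarrow> ('m \<Rightarrow> nat) \<Rightarrow> real" where
  "reward D s X = val D (capacity D - fst s + X) - val D (capacity D - fst s)"

text \<open>
  The law of the first \<open>n\<close> steps of the process under policy \<open>\<pi>\<close> started in \<open>s\<close>, as the list of pairs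
  of a visited state and the vector of items depleted there.
\<close>

primrec trajectory ::
  "('a, 'm::finite) depletion_problem \<Rightarrow> ('m state \<Rightarrow> 'a) \<Rightarrow> nat \<Rightarrow> 'm state \<Rightarrow>
    ('m state \<times> ('m \<Rightarrow> nat)) list pmf" where
  "trajectory D \<pi> 0 s = return_pmf []"
| "trajectory D \<pi> (Suc n) s =
     do {
       X \<leftarrow> depletion D s (\<pi> s);
       tr \<leftarrow> trajectory D \<pi> n (next_state s X);
       return_pmf ((s, X) # tr)
     }"

definition policies :: "('a, 'm::finite) depletion_problem \<Rightarrow> ('m state \<Rightarrow> 'a) set" where
  "policies D = (states D \<rightarrow>\<^sub>E activities D)"

definition policy_value ::
  "('a, 'm::finite) depletion_problem \<Rightarrow> ('m state \<Rightarrow> 'a) \<Rightarrow> 'm state \<Rightarrow> real" where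
  "policy_value D \<pi> s =
     measure_pmf.expectation (trajectory D \<pi> (horizon D - snd s) s)
       (\<lambda>tr. \<Sum>(s', X)\<leftarrow>tr. reward D s' X)"

definition opt_value :: "('a, 'm::finite) depletion_problem \<Rightarrow> 'm state \<Rightarrow> real" where
  "opt_value D s = Max ((\<lambda>\<pi>. policy_value D \<pi> s) ` policies D)"

text \<open>The maximum above ranges over a finite nonempty set.\<close>

lemma finite_states: "finite (states D)"
proof -
  have "{x. x \<le> capacity D} = (\<Pi>\<^sub>E m\<in>UNIV. {..capacity D m})"
    by (auto simp: le_fun_def PiE_def Pi_def)
  then have "finite {x. x \<le> capacity D}"
    by (simp add: finite_PiE)
  moreover have "states D = {x. x \<le> capacity D} \<times> {..horizon D}"
    by (auto simp: states_def)
  ultimately show ?thesis by simp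
qed

lemma finite_policies: "submodular_depletion_problem D \<Longrightarrow> finite (policies D)"
  by (simp add: policies_def submodular_depletion_problem_def finite_PiE finite_states)

lemma policies_nonempty: "submodular_depletion_problem D \<Longrightarrow> policies D \<noteq> {}"
  by (simp add: policies_def submodular_depletion_problem_def PiE_eq_empty_iff)

end

theory Submission
  imports Defs
begin

text \<open>
  With more items left, less value has been collected so far, so by submodularity every further
  item is worth at least as much; and more items are depleted. The proof makes this precise by
  induction on the number of remaining steps, on the optimality recursion \<open>bellman\<close>.

  The induction step uses a coupling: for \<open>x' \<le> x\<close>, a binomial number of depleted items out of
  \<open>x\<close> is the sum of independent binomial numbers out of \<open>x'\<close> and out of the \<open>x - x'\<close> additional
  items (\<open>binomial_pmf_add\<close>). Hence, under the same activity, the vectors \<open>X'\<close> and \<open>X\<close> depleted from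
  \<open>x'\<close> and from \<open>x\<close> can be realised jointly with \<open>X' \<le> X\<close> and \<open>x' - X' \<le> x - X\<close>
  (\<open>depletion_coupling\<close>). The first inequality, together with monotonicity and submodularity, makes
  the reward at least as large from \<open>x\<close> as from \<open>x'\<close> (\<open>reward_mono\<close>); the second makes the induction
  hypothesis applicable to the next states. So the value of using the activity that is optimal
  at \<open>x'\<close> is no smaller at \<open>x\<close>, hence neither is the optimal value (\<open>bellman_mono\<close>).

  Since the problem has a finite horizon and the time is part of the state, the maximum over policies
  satisfies that recursion: every policy is bounded by it, and the greedy policy attains it
  (\<open>opt_value_eq_bellman\<close>).
\<close>

section \<open>Coupling of the depletions from two item vectors\<close>

lemma binomial_pmf_add:
  assumes p: "p \<in> {0..1}"
  shows "binomial_pmf (m + n) p =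
    map_pmf (\<lambda>(i, j). i + j) (pair_pmf (binomial_pmf m p) (binomial_pmf n p))"
  by (induction m)
    (simp_all add: binomial_pmf_Suc[OF p] binomial_pmf_0[OF p] map_pmf_def pair_pmf_def
      bind_assoc_pmf bind_return_pmf bind_return_pmf' add.assoc)

lemma finite_set_depletion:
  assumes "submodular_depletion_problem D" "A \<in> activities D"
  shows "finite (set_pmf (depletion D s A))"
proof -
  have "depl_prob D t A m \<in> {0..1}" for t m
    using assms by (auto simp: submodular_depletion_problem_def)
  then show ?thesis
    by (auto simp: depletion_def set_Pi_pmf intro!: finite_PiE_dflt finite_set_pmf_binomial_pmf)
qed

text \<open>
  In the joint law \<open>C\<close>, the first component is the depletion from the smaller vector \<open>x'\<close>, and the
  second one is the depletion from \<open>x\<close>.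
\<close>

lemma depletion_coupling:
  fixes D :: "('a, 'm::finite) depletion_problem"
  assumes D: "submodular_depletion_problem D" and A: "A \<in> activities D" and le: "x' \<le> x"
  obtains C where
    "map_pmf fst C = depletion D (x', t) A"
    "map_pmf snd C = depletion D (x, t) A"
    "\<And>X' X. (X', X) \<in> set_pmf C \<Longrightarrow> X' \<le> X \<and> x' - X' \<le> x - X"
proof -
  define p where "p = depl_prob D t A"
  have p: "p m \<in> {0..1}" for m
    using D A by (auto simp: p_def submodular_depletion_problem_def)
  \<comment> \<open>\<open>Q\<close> records, for each type, the numbers depleted out of the \<open>x' m\<close> items and out of the
    \<open>x m - x' m\<close> additional ones.\<close>
  define Q where "Q = Pi_pmf UNIV (0, 0)
    (\<lambda>m. pair_pmf (binomial_pmf (x' m) (p m)) (binomial_pmf (x m - x' m) (p m)))"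
  define C where "C = map_pmf (\<lambda>f. (fst \<circ> f, (\<lambda>(i, j). i + j) \<circ> f)) Q"
  have "map_pmf fst C = map_pmf (\<lambda>f. fst \<circ> f) Q"
    by (simp add: C_def pmf.map_comp o_def)
  also have "\<dots> = depletion D (x', t) A"
    unfolding Q_def by (subst Pi_pmf_map[symmetric]) (simp_all add: depletion_def p_def map_fst_pair_pmf)
  finally have 1: "map_pmf fst C = depletion D (x', t) A" .
  have add: "binomial_pmf (x m) (p m) = map_pmf (\<lambda>(i, j). i + j)
      (pair_pmf (binomial_pmf (x' m) (p m)) (binomial_pmf (x m - x' m) (p m)))" for m
    using binomial_pmf_add[OF p[of m], of "x' m" "x m - x' m"] le by (simp add: le_fun_def)
  have "map_pmf snd C = map_pmf (\<lambda>f. (\<lambda>(i, j). i + j) \<circ> f) Q"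
    by (simp add: C_def pmf.map_comp o_def)
  also have "\<dots> = Pi_pmf UNIV 0 (\<lambda>m. binomial_pmf (x m) (p m))"
    unfolding Q_def add by (subst Pi_pmf_map[symmetric]) simp_all
  also have "\<dots> = depletion D (x, t) A"
    by (simp add: depletion_def p_def)
  finally have 2: "map_pmf snd C = depletion D (x, t) A" .
  have "X' \<le> X \<and> x' - X' \<le> x - X" if "(X', X) \<in> set_pmf C" for X' X
  proof -
    from that obtain f where f: "f \<in> set_pmf Q" and X': "X' = fst \<circ> f"
      and X: "X = (\<lambda>(i, j). i + j) \<circ> f"
      by (auto simp: C_def)
    have sub: "set_pmf (binomial_pmf n (p m)) \<subseteq> {..n}" for n m
      using p[of m] by (auto simp: set_pmf_binomial_eq split: if_splits)
    have "snd (f m) \<le> x m - x' m" for m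
    proof -
      have "f m \<in> set_pmf (pair_pmf (binomial_pmf (x' m) (p m)) (binomial_pmf (x m - x' m) (p m)))"
        using f by (simp add: Q_def set_Pi_pmf PiE_dflt_def)
      then have "snd (f m) \<in> set_pmf (binomial_pmf (x m - x' m) (p m))"
        by (auto simp: mem_Times_iff)
      then show ?thesis
        using sub by blast
    qed
    moreover have "x' m \<le> x m" for m
      using le by (simp add: le_fun_def)
    ultimately have "x' m - fst (f m) \<le> x m - (fst (f m) + snd (f m))" for m
      using le_diff_conv2[of "x' m" "x m" "snd (f m)"] by fastforce
    then show ?thesis
      by (simp add: X X' le_fun_def split_beta)
  qed
  with 1 2 show thesis by (rule that)
qed


section \<open>Monotonicity of the optimality recursion\<close>

lemma reward_mono:
  assumes D: "submodular_depletion_problem D" and x: "x' \<le> x" and X: "X' \<le> X"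
  shows "reward D (x', t) X' \<le> reward D (x, t) X"
proof -
  define y y' where "y = capacity D - x" and "y' = capacity D - x'"
  have "y \<le> y'"
    using x by (simp add: y_def y'_def le_fun_def diff_le_mono2)
  then have "val D (y' + X') - val D y' \<le> val D (y + X') - val D y"
    using D by (auto simp: submodular_depletion_problem_def submodular_def)
  moreover have "y + X' \<le> y + X"
    using X by (simp add: le_fun_def)
  then have "val D (y + X') \<le> val D (y + X)"
    using D by (simp add: submodular_depletion_problem_def monoD)
  ultimately show ?thesis
    by (simp add: reward_def y_def y'_def)
qed

text \<open>
  The optimal expected reward of the last \<open>n\<close> steps, when the item vector is \<open>x\<close> at time
  \<open>horizon D - n\<close>, by backward recursion. This reading needs \<open>n \<le> horizon D\<close> and
  \<open>x \<le> capacity D\<close>, so that the state is one of the problem, but \<open>bellman_mono\<close> does not.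
\<close>

primrec bellman :: "('a, 'm::finite) depletion_problem \<Rightarrow> nat \<Rightarrow> ('m \<Rightarrow> nat) \<Rightarrow> real" where
  "bellman D 0 x = 0"
| "bellman D (Suc n) x =
     (MAX A\<in>activities D. measure_pmf.expectation (depletion D (x, horizon D - Suc n) A)
       (\<lambda>X. reward D (x, horizon D - Suc n) X + bellman D n (x - X)))"

lemma bellman_mono:
  assumes D: "submodular_depletion_problem D" and le: "x' \<le> x"
  shows "bellman D n x' \<le> bellman D n x"
  using le
proof (induction n arbitrary: x x')
  case 0
  show ?case by simp
next
  case (Suc n)
  define t where "t = horizon D - Suc n"
  define q where "q x A = measure_pmf.expectation (depletion D (x, t) A)
    (\<lambda>X. reward D (x, t) X + bellman D n (x - X))" for x A
  have q: "q x' A \<le> q x A" if A: "A \<in> activities D" for A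
  proof -
    obtain C where C: "map_pmf fst C = depletion D (x', t) A" "map_pmf snd C = depletion D (x, t) A"
        and ord: "\<And>X' X. (X', X) \<in> set_pmf C \<Longrightarrow> X' \<le> X \<and> x' - X' \<le> x - X"
      using depletion_coupling[OF D A Suc.prems] by blast
    have "fst ` set_pmf C = set_pmf (depletion D (x', t) A)"
        "snd ` set_pmf C = set_pmf (depletion D (x, t) A)"
      using C by (metis set_map_pmf)+
    then have "set_pmf C \<subseteq> set_pmf (depletion D (x', t) A) \<times> set_pmf (depletion D (x, t) A)"
      by force
    then have fin: "finite (set_pmf C)"
      by (rule finite_subset) (simp add: finite_set_depletion[OF D A])
    have "q x' A = measure_pmf.expectation C
        (\<lambda>c. reward D (x', t) (fst c) + bellman D n (x' - fst c))"
      by (simp add: q_def C(1)[symmetric])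
    also have "\<dots> \<le> measure_pmf.expectation C
        (\<lambda>c. reward D (x, t) (snd c) + bellman D n (x - snd c))"
    proof (intro integral_mono_AE integrable_measure_pmf_finite fin AE_pmfI)
      fix c assume "c \<in> set_pmf C"
      then have "fst c \<le> snd c" "x' - fst c \<le> x - snd c"
        using ord[of "fst c" "snd c"] by simp_all
      then show "reward D (x', t) (fst c) + bellman D n (x' - fst c)
          \<le> reward D (x, t) (snd c) + bellman D n (x - snd c)"
        by (intro add_mono reward_mono[OF D Suc.prems] Suc.IH)
    qed
    also have "\<dots> = q x A"
      by (simp add: q_def C(2)[symmetric])
    finally show ?thesis .
  qed
  have fin: "finite (activities D)" "activities D \<noteq> {}"
    using D by (auto simp: submodular_depletion_problem_def)
  have "(MAX A\<in>activities D. q x' A) \<le> (MAX A\<in>activities D. q x A)"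
    using fin by (intro Max.boundedI) (auto intro: order_trans[OF q] Max_ge)
  then show ?case by (simp add: q_def t_def)
qed


section \<open>The optimal value satisfies the recursion\<close>

lemma policy_in_activities:
  assumes "\<pi> \<in> policies D" "x \<le> capacity D"
  shows "\<pi> (x, horizon D - n) \<in> activities D"
  using assms by (auto simp: policies_def states_def)

lemma next_state_horizon:
  assumes "Suc n \<le> horizon D"
  shows "next_state (x, horizon D - Suc n) X = (x - X, horizon D - n)"
  using assms by (simp add: next_state_def Suc_diff_Suc)

lemma diff_le_capacity:
  assumes "x \<le> capacity D"
  shows "x - X \<le> capacity D"
  using assms by (auto simp: le_fun_def intro: le_trans[OF diff_le_self])

lemma finite_set_trajectory:
  assumes D: "submodular_depletion_problem D" and \<pi>: "\<pi> \<in> policies D"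
    and "x \<le> capacity D" "n \<le> horizon D"
  shows "finite (set_pmf (trajectory D \<pi> n (x, horizon D - n)))"
  using assms(3,4)
proof (induction n arbitrary: x)
  case 0
  show ?case by simp
next
  case (Suc n)
  have "finite (set_pmf (trajectory D \<pi> n (x - X, horizon D - n)))" for X
    using Suc.prems by (intro Suc.IH diff_le_capacity) simp_all
  then show ?case
    using finite_set_depletion[OF D policy_in_activities[OF \<pi> Suc.prems(1)]]
    by (simp add: next_state_horizon[OF Suc.prems(2)])
qed

text \<open>The expected reward of the next \<open>n\<close> steps under a fixed policy.\<close>

definition steps_value ::
  "('a, 'm::finite) depletion_problem \<Rightarrow> ('m state \<Rightarrow> 'a) \<Rightarrow> nat \<Rightarrow> 'm state \<Rightarrow> real" where
  "steps_value D \<pi> n s =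
     measure_pmf.expectation (trajectory D \<pi> n s) (\<lambda>tr. \<Sum>(s', X)\<leftarrow>tr. reward D s' X)"

lemma expectation_bind_finite:
  fixes h :: "'b \<Rightarrow> real"
  assumes "finite (set_pmf p)" "\<And>x. x \<in> set_pmf p \<Longrightarrow> finite (set_pmf (f x))"
  shows "measure_pmf.expectation (bind_pmf p f) h =
    measure_pmf.expectation p (\<lambda>x. measure_pmf.expectation (f x) h)"
  using assms
  by (subst pmf_expectation_bind[where A = "set_pmf p"])
    (simp_all add: integral_measure_pmf[where A = "set_pmf p"])

lemma steps_value_Suc:
  assumes D: "submodular_depletion_problem D" and \<pi>: "\<pi> \<in> policies D"
    and x: "x \<le> capacity D" and n: "Suc n \<le> horizon D"
  defines "s \<equiv> (x, horizon D - Suc n)"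
  shows "steps_value D \<pi> (Suc n) s = measure_pmf.expectation (depletion D s (\<pi> s))
    (\<lambda>X. reward D s X + steps_value D \<pi> n (x - X, horizon D - n))"
proof -
  have fin: "finite (set_pmf (depletion D s (\<pi> s)))"
    unfolding s_def by (intro finite_set_depletion[OF D] policy_in_activities[OF \<pi> x])
  have fin': "finite (set_pmf (trajectory D \<pi> n (x - X, horizon D - n)))" for X
    using n by (intro finite_set_trajectory[OF D \<pi>] diff_le_capacity[OF x]) simp
  have next_s: "next_state s X = (x - X, horizon D - n)" for X
    unfolding s_def by (rule next_state_horizon[OF n])
  show ?thesis
    unfolding steps_value_def trajectory.simps next_s
    by (simp add: expectation_bind_finite fin fin' map_pmf_def[symmetric]
        integrable_measure_pmf_finite)
qed

lemma steps_value_le_bellman: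
  assumes D: "submodular_depletion_problem D" and \<pi>: "\<pi> \<in> policies D"
    and "x \<le> capacity D" "n \<le> horizon D"
  shows "steps_value D \<pi> n (x, horizon D - n) \<le> bellman D n x"
  using assms(3,4)
proof (induction n arbitrary: x)
  case 0
  show ?case by (simp add: steps_value_def)
next
  case (Suc n)
  define s where "s = (x, horizon D - Suc n)"
  have A: "\<pi> s \<in> activities D"
    unfolding s_def by (rule policy_in_activities[OF \<pi> Suc.prems(1)])
  have "steps_value D \<pi> (Suc n) s = measure_pmf.expectation (depletion D s (\<pi> s))
      (\<lambda>X. reward D s X + steps_value D \<pi> n (x - X, horizon D - n))"
    unfolding s_def by (rule steps_value_Suc[OF D \<pi> Suc.prems])
  also have "\<dots> \<le> measure_pmf.expectation (depletion D s (\<pi> s))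
      (\<lambda>X. reward D s X + bellman D n (x - X))"
    using Suc.prems
    by (intro integral_mono integrable_measure_pmf_finite finite_set_depletion[OF D A]
        add_left_mono Suc.IH diff_le_capacity) simp_all
  also have "\<dots> \<le> bellman D (Suc n) x"
    using D A by (auto simp: s_def submodular_depletion_problem_def intro!: Max_ge)
  finally show ?case by (simp add: s_def)
qed

lemma greedy_policy:
  fixes D :: "('a, 'm::finite) depletion_problem"
  assumes D: "submodular_depletion_problem D"
  obtains \<pi> where "\<pi> \<in> policies D"
    "\<And>x n. x \<le> capacity D \<Longrightarrow> n \<le> horizon D \<Longrightarrow>
       steps_value D \<pi> n (x, horizon D - n) = bellman D n x"
proof -
  \<comment> \<open>\<open>q x t A\<close> is the value of using \<open>A\<close> at time \<open>t\<close> and continuing optimally from time \<open>Suc t\<close>.\<close>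
  define q where "q x t A = measure_pmf.expectation (depletion D (x, t) A)
    (\<lambda>X. reward D (x, t) X + bellman D (horizon D - Suc t) (x - X))" for x t A
  have fin: "finite (activities D)" "activities D \<noteq> {}"
    using D by (auto simp: submodular_depletion_problem_def)
  have "\<exists>A\<in>activities D. q x t A = (MAX A\<in>activities D. q x t A)" for x t
    using Max_in[of "q x t ` activities D"] fin by fastforce
  then obtain g where g: "\<And>x t. g x t \<in> activities D"
      and gmax: "\<And>x t. q x t (g x t) = (MAX A\<in>activities D. q x t A)"
    by metis
  define \<pi> where "\<pi> = restrict (\<lambda>(x, t). g x t) (states D)"
  have \<pi>: "\<pi> \<in> policies D"
    using g by (auto simp: \<pi>_def policies_def)
  have "steps_value D \<pi> n (x, horizon D - n) = bellman D n x"
    if "x \<le> capacity D" "n \<le> horizon D" for x n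
    using that
  proof (induction n arbitrary: x)
    case 0
    show ?case by (simp add: steps_value_def)
  next
    case (Suc n)
    define t where "t = horizon D - Suc n"
    have t: "horizon D - Suc t = n"
      using Suc.prems by (simp add: t_def)
    have \<pi>g: "\<pi> (x, t) = g x t"
      using Suc.prems by (simp add: \<pi>_def t_def states_def)
    have IH: "steps_value D \<pi> n (x - X, horizon D - n) = bellman D n (x - X)" for X
      using Suc.prems by (intro Suc.IH diff_le_capacity) simp_all
    have "steps_value D \<pi> (Suc n) (x, t) = q x t (\<pi> (x, t))"
      unfolding q_def t by (simp add: t_def steps_value_Suc[OF D \<pi> Suc.prems] IH)
    also have "\<dots> = (MAX A\<in>activities D. q x t A)"
      by (simp add: \<pi>g gmax)
    also have "\<dots> = bellman D (Suc n) x"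
      by (simp add: q_def t) (simp add: t_def)
    finally show ?case by (simp add: t_def)
  qed
  with \<pi> show thesis by (rule that)
qed

lemma opt_value_eq_bellman:
  assumes D: "submodular_depletion_problem D" and s: "s \<in> states D"
  shows "opt_value D s = bellman D (horizon D - snd s) (fst s)"
proof -
  define n where "n = horizon D - snd s"
  have x: "fst s \<le> capacity D" and n: "n \<le> horizon D" and s_eq: "s = (fst s, horizon D - n)"
    using s by (auto simp: states_def n_def)
  have val: "policy_value D \<pi> s = steps_value D \<pi> n (fst s, horizon D - n)" for \<pi>
    using s_eq by (simp add: policy_value_def steps_value_def n_def)
  obtain \<pi> where \<pi>: "\<pi> \<in> policies D"
      "steps_value D \<pi> n (fst s, horizon D - n) = bellman D n (fst s)"
    using greedy_policy[OF D] x n by metis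
  have "Max ((\<lambda>\<pi>. policy_value D \<pi> s) ` policies D) = bellman D n (fst s)"
  proof (rule Max_eqI)
    show "finite ((\<lambda>\<pi>. policy_value D \<pi> s) ` policies D)"
      using finite_policies[OF D] by simp
    show "v \<le> bellman D n (fst s)" if "v \<in> (\<lambda>\<pi>. policy_value D \<pi> s) ` policies D" for v
      using that steps_value_le_bellman[OF D _ x n] by (auto simp: val)
    show "bellman D n (fst s) \<in> (\<lambda>\<pi>. policy_value D \<pi> s) ` policies D"
      using \<pi> by (auto simp: val intro!: rev_image_eqI)
  qed
  then show ?thesis by (simp add: opt_value_def n_def)
qed


section \<open>Monotonicity of the optimal value\<close>

theorem lemma2:
  fixes D :: "('a, 'm::finite) depletion_problem"
  assumes "submodular_depletion_problem D"
    and "s \<in> states D" and "s' \<in> states D"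
    and "fst s \<ge> fst s'" and "snd s = snd s'"
  shows "opt_value D s \<ge> opt_value D s'"
  using assms by (simp add: opt_value_eq_bellman bellman_mono)

end
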